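(* Fix an irrational point $P\in\mathscr{Q}$. For any rational point $Z\in\mathscr{Q}$ there exists $k\ge0$ such that \[ \min\{\delta(P;Z_k^{(1,0)}(P)),\ \delta(P;Z_k^{(0,1)}(P))\}\le\delta(P;Z). \]
   Context: $\mathscr{Q}=\{(x,y)\in\mathbb{R}^2: x^2+y^2=1,\ x,y\ge0\}$; a point is irrational if it is not in $\mathbb{Q}^2$. Romik's map is $\mathcal{T}(x,y)=\left(\frac{|2-x-2y|}{3-2x-2y},\frac{|2-2x-y|}{3-2x-2y}\right)$; the digit of $(x,y)$ is $1$ if $4/5\le x\le1$, $2$ if $3/5\le x\le4/5$, $3$ if $0\le x\le 3/5$. An irrational $P$ has a unique digit expansion $[d_1,d_2,\dots]$, $d_j$ being the digit of $\mathcal{T}^{j-1}(P)$. Let $M_1=\begin{pmatrix}-1&2&2\\-2&1&2\\-2&2&3\end{pmatrix}$, $M_2=\begin{pmatrix}1&2&2\\2&1&2\\2&2&3\end{pmatrix}$, $M_3=\begin{pmatrix}1&-2&2\\2&-1&2\\2&-2&3\end{pmatrix}$. For $k\ge0$, $Z_k^{(1,0)}(P)$ (resp. $Z_k^{(0,1)}(P)$) is the point $(a/c,b/c)$ where $(a,b,c)^T=M_{d_1}\cdots M_{d_k}(1,0,1)^T$ (resp. $M_{d_1}\cdots M_{d_k}(0,1,1)^T$); for $k=0$ the product is the identity. These are the endpoints of the arc of points whose expansion begins with $d_1,\dots,d_k$. For a rational $Z=(a/c,b/c)\in\mathscr{Q}$ with integers $c>0$, $\gcd(a,b,c)=1$,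 the height is $\mathrm{Ht}(Z)=c$, and for $P\in\mathscr{Q}$, $\delta(P;Z)=\mathrm{Ht}(Z)\cdot|P-Z|$ with $|\cdot|$ the Euclidean distance. *)

theory Defs
  imports "HOL-Analysis.Analysis"
begin

text \<open>The type \<^typ>\<open>real \<times> real\<close> carries the Euclidean norm, so \<open>norm (P - Z)\<close> below is the
  Euclidean distance in the plane.\<close>

definition quarter_circle :: "(real \<times> real) set" where
  "quarter_circle = {(x, y). x\<^sup>2 + y\<^sup>2 = 1 \<and> x \<ge> 0 \<and> y \<ge> 0}"

definition rational_point :: "real \<times> real \<Rightarrow> bool" where
  "rational_point P \<longleftrightarrow> P \<in> \<rat> \<times> \<rat>"

definition romik :: "real \<times> real \<Rightarrow> real \<times> real" where
  "romik = (\<lambda>(x, y). (\<bar>2 - x - 2 * y\<bar> / (3 - 2 * x - 2 * y),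
                       \<bar>2 - 2 * x - y\<bar> / (3 - 2 * x - 2 * y)))"

text \<open>The closed arcs defining the digits overlap only in the rational points \<open>(4/5, 3/5)\<close> and
  \<open>(3/5, 4/5)\<close>. There the smaller digit is chosen; this has no effect on irrational points,
  whose \<open>romik\<close>-orbits consist of irrational points.\<close>

definition romik_digit :: "real \<times> real \<Rightarrow> nat" where
  "romik_digit P = (if 4 / 5 \<le> fst P then 1 else if 3 / 5 \<le> fst P then 2 else 3)"

text \<open>The expansion \<open>[d\<^sub>1, d\<^sub>2, \<dots>]\<close> is indexed from 1; the value at index 0 is never used.\<close>

definition romik_expansion :: "real \<times> real \<Rightarrow> nat \<Rightarrow> nat" where
  "romik_expansion P j = romik_digit ((romik ^^ (j - 1)) P)"

definition romik_matrix :: "nat \<Rightarrow> int^3^3" where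
  "romik_matrix d =
     (if d = 1 then vector [vector [-1, 2, 2], vector [-2, 1, 2], vector [-2, 2, 3]]
      else if d = 2 then vector [vector [1, 2, 2], vector [2, 1, 2], vector [2, 2, 3]]
      else vector [vector [1, -2, 2], vector [2, -1, 2], vector [2, -2, 3]])"

primrec romik_product :: "(nat \<Rightarrow> nat) \<Rightarrow> nat \<Rightarrow> int^3^3" where
  "romik_product d 0 = mat 1"
| "romik_product d (Suc k) = romik_product d k ** romik_matrix (d (Suc k))"

definition point_of_triple :: "int^3 \<Rightarrow> real \<times> real" where
  "point_of_triple v = (of_int (v $ 1) / of_int (v $ 3), of_int (v $ 2) / of_int (v $ 3))"

definition Z10 :: "nat \<Rightarrow> real \<times> real \<Rightarrow> real \<times> real" where
  "Z10 k P = point_of_triple (romik_product (romik_expansion P) k *v vector [1, 0, 1])"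

definition Z01 :: "nat \<Rightarrow> real \<times> real \<Rightarrow> real \<times> real" where
  "Z01 k P = point_of_triple (romik_product (romik_expansion P) k *v vector [0, 1, 1])"

text \<open>Meaningful for rational points only, where the reduced common denominator exists and is
  unique.\<close>

definition Ht :: "real \<times> real \<Rightarrow> int" where
  "Ht Z = (THE c. c > 0 \<and>
     (\<exists>a b. Gcd {a, b, c} = 1 \<and> Z = (of_int a / of_int c, of_int b / of_int c)))"

definition delta :: "real \<times> real \<Rightarrow> real \<times> real \<Rightarrow> real" where
  "delta P Z = of_int (Ht Z) * norm (P - Z)"

end

theory Submission
  imports Defs
begin

text \<open>Identify \<open>P = (x, y)\<close> with the vector \<open>(x, y, 1)\<close> on the light cone of the Lorentz form. If
  \<open>Z\<close> has reduced triple \<open>v = (a, b, c)\<close>, then \<open>\<delta>(P; Z)\<^sup>2 = 2 c (c - x a - y b)\<close>. The matrices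
  \<open>M\<^sub>d\<close> preserve the form, so pulling \<open>v\<close> back along the digits of \<open>P\<close> only rescales the
  second factor and replaces \<open>c\<close> by another linear functional. As long as \<open>Z\<close> lies in the arc
  given by the digits of \<open>P\<close>, the last entry of the pulled-back triple strictly decreases, so either
  \<open>Z\<close> becomes an endpoint or a digit of \<open>P\<close> separates it from \<open>P\<close>. In the latter case use the spinor
  coordinates \<open>X = sqrt (c - b)\<close>, \<open>Y = sqrt (c - a)\<close>: the height functional becomes a quadratic form
  with nonnegative coefficients, the pairing with \<open>P\<close> becomes \<open>(X t - Y s)\<^sup>2\<close>, and the separating
  endpoint is no worse than \<open>Z\<close> unless \<open>X = 1\<close> or \<open>Y = 1\<close>, in which case an endpoint of the
  previous arc wins.\<close>

section \<open>Heights\<close>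

text \<open>The number \<open>c\<close> divides \<open>a * c'\<close>, \<open>b * c'\<close> and
  \<open>c * c'\<close>, hence also their gcd, which is \<open>c'\<close> since \<open>a\<close>,
  \<open>b\<close>, \<open>c\<close> have gcd 1. Used in both directions, this makes the height
  unique.\<close>

lemma reduced_denominator_dvd:
  fixes a b c a' b' c' :: int
  assumes "c > 0" "c' > 0" "Gcd {a, b, c} = 1"
    and "real_of_int a / of_int c = of_int a' / of_int c'"
    and "real_of_int b / of_int c = of_int b' / of_int c'"
  shows "c dvd c'"
proof -
  have 1: "a * c' = a' * c"
  proof -
    have "real_of_int (a * c') = of_int (a' * c)"
      using assms(1,2,4) by (simp add: field_simps)
    then show ?thesis by linarith
  qed
  have 2: "b * c' = b' * c"
  proof -
    have "real_of_int (b * c') = of_int (b' * c)"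
      using assms(1,2,5) by (simp add: field_simps)
    then show ?thesis by linarith
  qed
  have "c dvd gcd (a * c') (gcd (b * c') (c * c'))"
    unfolding 1 2 by simp
  also have "\<dots> = gcd a (gcd b c) * c'"
    using assms(2) gcd_mult_distrib_int[of c' b c] gcd_mult_distrib_int[of c' a "gcd b c"]
    by (simp add: mult.commute)
  also have "\<dots> = c'"
    using assms(3) by simp
  finally show ?thesis .
qed

lemma Ht_eqI:
  assumes "c > 0" "Gcd {a, b, c} = 1"
  shows "Ht (of_int a / of_int c, of_int b / of_int c) = c"
  unfolding Ht_def
proof (rule the_equality)
  fix c' :: int
  assume "c' > 0 \<and> (\<exists>a' b'. Gcd {a', b', c'} = 1 \<and>
    (real_of_int a / of_int c, real_of_int b / of_int c) = (of_int a' / of_int c', of_int b' / of_int c'))"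
  then obtain a' b' where "c' > 0" "Gcd {a', b', c'} = 1"
    "real_of_int a / of_int c = of_int a' / of_int c'"
    "real_of_int b / of_int c = of_int b' / of_int c'"
    unfolding prod.inject by blast
  then have "c dvd c'" "c' dvd c"
    using reduced_denominator_dvd assms by metis+
  then show "c' = c"
    using \<open>c' > 0\<close> assms(1) by (simp add: zdvd_antisym_nonneg)
qed (use assms in blast)

lemma reduced_triple:
  fixes a b c :: int
  assumes "c > 0"
  obtains a' b' c' where "0 < c'" "c' \<le> c" "Gcd {a', b', c'} = 1"
    "real_of_int a / of_int c = of_int a' / of_int c'"
    "real_of_int b / of_int c = of_int b' / of_int c'"
proof -
  define g where "g = gcd a (gcd b c)"
  have g: "g > 0" using assms by (auto simp: g_def)
  have dvd: "g dvd a" "g dvd b" "g dvd c"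
    unfolding g_def by (meson dvd_trans gcd_dvd1 gcd_dvd2)+
  then obtain a' b' c' where e: "a = g * a'" "b = g * b'" "c = g * c'"
    by (auto elim!: dvdE)
  have c': "c' > 0" using assms g e(3) by (simp add: zero_less_mult_iff)
  have "g * gcd a' (gcd b' c') = g"
    using g unfolding e gcd_mult_distrib_int[of g]
    by (metis abs_of_pos e g_def gcd_mult_distrib_int)
  then have "Gcd {a', b', c'} = 1" using g by simp
  moreover have "c' \<le> c" unfolding e using g c' by simp
  ultimately show thesis
    using that[of c' a' b'] c' g unfolding e by simp
qed

text \<open>Cancelling the gcd can only shrink the denominator, so the bound also applies to triples
  not known to be primitive.\<close>

lemma Ht_le:
  assumes "c > 0"
  shows "0 < Ht (of_int a / of_int c, of_int b / of_int c)"
    and "Ht (of_int a / of_int c, of_int b / of_int c) \<le> c"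
proof -
  obtain a' b' c' where "0 < c'" "c' \<le> c" "Gcd {a', b', c'} = 1"
    "real_of_int a / of_int c = of_int a' / of_int c'"
    "real_of_int b / of_int c = of_int b' / of_int c'"
    by (rule reduced_triple[OF assms, of a b])
  then show "0 < Ht (of_int a / of_int c, of_int b / of_int c)"
    and "Ht (of_int a / of_int c, of_int b / of_int c) \<le> c"
    using Ht_eqI by metis+
qed

lemma Ht_attained:
  assumes "rational_point Z"
  obtains a b where "0 < Ht Z" "Z = (of_int a / of_int (Ht Z), of_int b / of_int (Ht Z))"
proof -
  obtain r q where Z: "Z = (r, q)" "r \<in> \<rat>" "q \<in> \<rat>"
    using assms by (auto simp: rational_point_def)
  obtain m n where m: "n > 0" "r = of_int m / of_int n"
    using Rats_cases'[OF Z(2)] by metis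
  obtain k l where k: "l > 0" "q = of_int k / of_int l"
    using Rats_cases'[OF Z(3)] by metis
  have 0: "n * l > 0" using m k by simp
  have 1: "r = of_int (m * l) / of_int (n * l)" "q = of_int (k * n) / of_int (n * l)"
    using m k by simp_all
  obtain a' b' c' where "0 < c'" "c' \<le> n * l" "Gcd {a', b', c'} = 1"
    "r = of_int a' / of_int c'" "q = of_int b' / of_int c'"
    unfolding 1 by (rule reduced_triple[OF 0, of "m * l" "k * n"])
  then show thesis using that[of a' b'] Ht_eqI[of c' a' b'] Z(1) by simp
qed

section \<open>Light-like triples\<close>

text \<open>Pythagorean triples with nonnegative legs; non-primitive triples and degenerate ones on
  the axes are included.\<close>

definition light :: "int^3 \<Rightarrow> bool" where
  "light v \<longleftrightarrow> v $ 1 \<ge> 0 \<and> v $ 2 \<ge> 0 \<and> v $ 3 > 0 \<and> (v $ 1)\<^sup>2 + (v $ 2)\<^sup>2 = (v $ 3)\<^sup>2"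

text \<open>Minus the Lorentz product of \<open>(x, y, 1)\<close> and \<open>v\<close> for the form
  of signature \<open>(+, +, -)\<close>.\<close>

definition pairing :: "real \<times> real \<Rightarrow> int^3 \<Rightarrow> real" where
  "pairing P v = of_int (v $ 3) - fst P * of_int (v $ 1) - snd P * of_int (v $ 2)"

text \<open>Both points are unit vectors, so the squared distance is 2 minus twice their inner
  product. The height stays separate from \<open>v $ 3\<close> because \<open>v\<close> may be
  unreduced.\<close>

lemma delta_eq_sqrt:
  assumes "P \<in> quarter_circle" "light v"
  shows "delta P (point_of_triple v) =
    of_int (Ht (point_of_triple v)) * sqrt (2 * pairing P v / of_int (v $ 3))"
proof -
  obtain x y where P: "P = (x, y)" "x\<^sup>2 + y\<^sup>2 = 1"
    using assms(1) by (auto simp: quarter_circle_def)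
  define a b c where "a = real_of_int (v $ 1)" "b = real_of_int (v $ 2)" "c = real_of_int (v $ 3)"
  have c: "c > 0" and n: "a\<^sup>2 + b\<^sup>2 = c\<^sup>2"
    using assms(2) by (auto simp: light_def a_b_c_def simp flip: of_int_power of_int_add)
  have "(x - a / c)\<^sup>2 + (y - b / c)\<^sup>2 = (x\<^sup>2 + y\<^sup>2) + (a\<^sup>2 + b\<^sup>2) / c\<^sup>2 - 2 * (x * a + y * b) / c"
    using c by (simp add: field_simps power2_eq_square)
  also have "\<dots> = 2 * (c - x * a - y * b) / c"
    unfolding n P using c by (simp add: field_simps)
  finally show ?thesis
    by (simp add: delta_def point_of_triple_def pairing_def P norm_Pair flip: a_b_c_def)
qed

text \<open>This is the Cauchy-Schwarz inequality, obtained from Lagrange's identity.\<close>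

lemma pairing_nonneg:
  assumes "P \<in> quarter_circle" "light v"
  shows "pairing P v \<ge> 0"
proof -
  obtain x y where P: "P = (x, y)" "x\<^sup>2 + y\<^sup>2 = 1"
    using assms(1) by (auto simp: quarter_circle_def)
  define a b c where "a = real_of_int (v $ 1)" "b = real_of_int (v $ 2)" "c = real_of_int (v $ 3)"
  have c: "c > 0" and n: "a\<^sup>2 + b\<^sup>2 = c\<^sup>2"
    using assms(2) by (auto simp: light_def a_b_c_def simp flip: of_int_power of_int_add)
  have "(x * a + y * b)\<^sup>2 + (x * b - y * a)\<^sup>2 = (x\<^sup>2 + y\<^sup>2) * (a\<^sup>2 + b\<^sup>2)"
    by algebra
  then have "(x * a + y * b)\<^sup>2 + (x * b - y * a)\<^sup>2 = c\<^sup>2"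
    unfolding n P by simp
  then have "(x * a + y * b)\<^sup>2 \<le> c\<^sup>2"
    by (smt (verit) zero_le_power2)
  then have "x * a + y * b \<le> c"
    using c by (meson less_eq_real_def power2_le_imp_le)
  then show ?thesis by (simp add: pairing_def P flip: a_b_c_def)
qed

text \<open>Only the triple \<open>v\<close> has to be reduced: for \<open>w\<close>, the height is at most the last entry.\<close>

lemma delta_mono:
  assumes "P \<in> quarter_circle" "light v" "light w"
    and "Ht (point_of_triple v) = v $ 3"
    and "of_int (w $ 3) * pairing P w \<le> of_int (v $ 3) * pairing P v"
  shows "delta P (point_of_triple w) \<le> delta P (point_of_triple v)"
proof -
  \<comment> \<open>Moving \<open>c\<close> under the root reduces the comparison of
    \<open>delta\<close> to one of the products of last entry and pairing.\<close>
  have eq: "c * sqrt (2 * p / c) = sqrt (2 * (c * p))" if "c > 0" for c p :: real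
  proof -
    have "c * sqrt (2 * p / c) = sqrt (c\<^sup>2) * sqrt (2 * p / c)" using that by simp
    also have "\<dots> = sqrt (c\<^sup>2 * (2 * p / c))" by (rule real_sqrt_mult[symmetric])
    also have "c\<^sup>2 * (2 * p / c) = 2 * (c * p)" using that by (simp add: power2_eq_square)
    finally show ?thesis .
  qed
  have pos: "v $ 3 > 0" "w $ 3 > 0" using assms by (auto simp: light_def)
  have "Ht (point_of_triple w) \<le> w $ 3"
    unfolding point_of_triple_def by (rule Ht_le(2)[OF pos(2)])
  then have "delta P (point_of_triple w) \<le> of_int (w $ 3) * sqrt (2 * pairing P w / of_int (w $ 3))"
    unfolding delta_eq_sqrt[OF assms(1,3)]
    using pairing_nonneg[OF assms(1,3)] pos by (intro mult_right_mono) auto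
  also have "\<dots> = sqrt (2 * (of_int (w $ 3) * pairing P w))" using pos by (intro eq) simp
  also have "\<dots> \<le> sqrt (2 * (of_int (v $ 3) * pairing P v))" using assms(5) by simp
  also have "\<dots> = of_int (v $ 3) * sqrt (2 * pairing P v / of_int (v $ 3))"
    using pos by (intro eq[symmetric]) simp
  also have "\<dots> = delta P (point_of_triple v)"
    unfolding delta_eq_sqrt[OF assms(1,2)] assms(4) ..
  finally show ?thesis .
qed

section \<open>Romik's matrices\<close>

lemma romik_matrix_vector:
  "romik_matrix 1 *v v = vector [- v$1 + 2 * v$2 + 2 * v$3, - 2 * v$1 + v$2 + 2 * v$3, - 2 * v$1 + 2 * v$2 + 3 * v$3]"
  "romik_matrix 2 *v v = vector [v$1 + 2 * v$2 + 2 * v$3, 2 * v$1 + v$2 + 2 * v$3, 2 * v$1 + 2 * v$2 + 3 * v$3]"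
  "romik_matrix 3 *v v = vector [v$1 - 2 * v$2 + 2 * v$3, 2 * v$1 - v$2 + 2 * v$3, 2 * v$1 - 2 * v$2 + 3 * v$3]"
  by (simp_all add: romik_matrix_def vec_eq_iff forall_3 matrix_vector_mult_def sum_3)

lemma romik_digit_cases:
  obtains "romik_digit P = 1" | "romik_digit P = 2" | "romik_digit P = 3"
  by (metis romik_digit_def)

lemma light_le:
  assumes "light v"
  shows "v $ 1 \<le> v $ 3" "v $ 2 \<le> v $ 3"
proof -
  have "(v $ 1)\<^sup>2 \<le> (v $ 3)\<^sup>2" "(v $ 2)\<^sup>2 \<le> (v $ 3)\<^sup>2" "v $ 3 \<ge> 0"
    using assms unfolding light_def by (smt (verit) zero_le_power2)+
  then show "v $ 1 \<le> v $ 3" "v $ 2 \<le> v $ 3"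
    by (meson power2_le_imp_le)+
qed

text \<open>The square identities say that the matrices preserve the Lorentz form; the signs of the
  entries follow from \<open>light_le\<close>.\<close>

lemma light_romik_matrix:
  assumes "light v"
  shows "light (romik_matrix (romik_digit Q) *v v)"
proof -
  have sq: "(v $ 1)\<^sup>2 + (v $ 2)\<^sup>2 = (v $ 3)\<^sup>2" and *: "v $ 1 \<ge> 0" "v $ 2 \<ge> 0" "v $ 3 > 0"
    using assms by (auto simp: light_def)
  note le = light_le[OF assms]
  show ?thesis
  proof (cases rule: romik_digit_cases[of Q])
    case 1
    have "(- v$1 + 2 * v$2 + 2 * v$3)\<^sup>2 + (- 2 * v$1 + v$2 + 2 * v$3)\<^sup>2 = (- 2 * v$1 + 2 * v$2 + 3 * v$3)\<^sup>2"
      using sq by algebra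
    then show ?thesis using 1 * le by (simp add: romik_matrix_vector[unfolded One_nat_def] light_def)
  next
    case 2
    have "(v$1 + 2 * v$2 + 2 * v$3)\<^sup>2 + (2 * v$1 + v$2 + 2 * v$3)\<^sup>2 = (2 * v$1 + 2 * v$2 + 3 * v$3)\<^sup>2"
      using sq by algebra
    then show ?thesis using 2 * le by (simp add: romik_matrix_vector light_def)
  next
    case 3
    have "(v$1 - 2 * v$2 + 2 * v$3)\<^sup>2 + (2 * v$1 - v$2 + 2 * v$3)\<^sup>2 = (2 * v$1 - 2 * v$2 + 3 * v$3)\<^sup>2"
      using sq by algebra
    then show ?thesis using 3 * le by (simp add: romik_matrix_vector light_def)
  qed
qed

lemma light_romik_product:
  assumes "light v"
  shows "light (romik_product (romik_expansion P) k *v v)"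
  using assms
proof (induction k arbitrary: v)
  case (Suc k)
  then show ?case
    by (simp add: romik_expansion_def light_romik_matrix flip: matrix_vector_mul_assoc)
qed simp

text \<open>The line \<open>x + 2 * y = 2\<close> is the chord from \<open>(0, 1)\<close> to
  \<open>(4/5, 3/5)\<close>, and \<open>2 * x + y = 2\<close> the one from \<open>(1, 0)\<close> to
  \<open>(3/5, 4/5)\<close>. Digits thus become signs of the linear forms inside the absolute values
  of \<open>romik\<close>.\<close>

lemma romik_digit_arc:
  assumes "(x, y) \<in> quarter_circle"
  shows "romik_digit (x, y) = 1 \<Longrightarrow> x + 2 * y \<le> 2 \<and> 2 * x + y \<ge> 2"
    and "romik_digit (x, y) = 2 \<Longrightarrow> x + 2 * y \<ge> 2 \<and> 2 * x + y \<ge> 2"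
    and "romik_digit (x, y) = 3 \<Longrightarrow> x + 2 * y \<ge> 2 \<and> 2 * x + y \<le> 2"
proof -
  have *: "x\<^sup>2 + y\<^sup>2 = 1" "x \<ge> 0" "y \<ge> 0"
    using assms by (auto simp: quarter_circle_def)
  have "x\<^sup>2 \<le> 1\<^sup>2" using *(1) zero_le_power2[of y] unfolding one_power2 by linarith
  then have x1: "x \<le> 1" by (rule power2_le_imp_le) simp
  \<comment> \<open>On the circle these differences of squares depend on \<open>x\<close> alone and
    vanish exactly at the abscissas of the chord's two ends.\<close>
  have e1: "(2 - x)\<^sup>2 - (2 * y)\<^sup>2 = x * (5 * x - 4)" using *(1) by algebra
  have e2: "y\<^sup>2 - (2 - 2 * x)\<^sup>2 = (1 - x) * (5 * x - 3)" using *(1) by algebra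
  have A: "x + 2 * y \<le> 2" if "x \<ge> 4/5"
  proof -
    have "x * (5 * x - 4) \<ge> 0" using that by (intro mult_nonneg_nonneg) auto
    then have "(2 * y)\<^sup>2 \<le> (2 - x)\<^sup>2" using e1 by linarith
    then show ?thesis using x1 power2_le_imp_le[of "2 * y" "2 - x"] by simp
  qed
  have B: "x + 2 * y \<ge> 2" if "x \<le> 4/5"
  proof -
    have "x * (5 * x - 4) \<le> 0" using * that by (intro mult_nonneg_nonpos) auto
    then have "(2 - x)\<^sup>2 \<le> (2 * y)\<^sup>2" using e1 by linarith
    then show ?thesis using * power2_le_imp_le[of "2 - x" "2 * y"] by simp
  qed
  have C: "2 * x + y \<ge> 2" if "x \<ge> 3/5"
  proof -
    have "(1 - x) * (5 * x - 3) \<ge> 0" using x1 that by (intro mult_nonneg_nonneg) auto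
    then have "(2 - 2 * x)\<^sup>2 \<le> y\<^sup>2" using e2 by linarith
    then show ?thesis using * power2_le_imp_le[of "2 - 2 * x" y] by simp
  qed
  have D: "2 * x + y \<le> 2" if "x \<le> 3/5"
  proof -
    have "(1 - x) * (5 * x - 3) \<le> 0" using x1 that by (intro mult_nonneg_nonpos) auto
    then have "y\<^sup>2 \<le> (2 - 2 * x)\<^sup>2" using e2 by linarith
    then show ?thesis using x1 power2_le_imp_le[of y "2 - 2 * x"] by simp
  qed
  show "romik_digit (x, y) = 1 \<Longrightarrow> x + 2 * y \<le> 2 \<and> 2 * x + y \<ge> 2"
    using A C by (auto simp: romik_digit_def split: if_splits)
  show "romik_digit (x, y) = 2 \<Longrightarrow> x + 2 * y \<ge> 2 \<and> 2 * x + y \<ge> 2"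
    using B C by (auto simp: romik_digit_def split: if_splits)
  show "romik_digit (x, y) = 3 \<Longrightarrow> x + 2 * y \<ge> 2 \<and> 2 * x + y \<le> 2"
    using B D by (auto simp: romik_digit_def split: if_splits)
qed

text \<open>On the unit circle \<open>x + y\<close> is at most \<open>sqrt 2\<close>, which is below
  \<open>3/2\<close>.\<close>

lemma romik_denominator_pos:
  fixes x y :: real
  assumes "x\<^sup>2 + y\<^sup>2 = 1"
  shows "3 - 2 * x - 2 * y > 0"
proof -
  have "(x + y)\<^sup>2 + (x - y)\<^sup>2 = 2" using assms by algebra
  then have "(x + y)\<^sup>2 \<le> 2" by (smt (verit) zero_le_power2)
  also have "\<dots> < (3/2)\<^sup>2" by (simp add: power2_eq_square)
  finally have "x + y < 3/2" by (rule power2_less_imp_less) simp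
  then show ?thesis by simp
qed

lemma romik_quarter_circle:
  assumes "P \<in> quarter_circle"
  shows "romik P \<in> quarter_circle"
proof -
  obtain x y where P: "P = (x, y)" "x\<^sup>2 + y\<^sup>2 = 1"
    using assms by (auto simp: quarter_circle_def)
  have pos: "3 - 2 * x - 2 * y > 0" using P(2) by (rule romik_denominator_pos)
  have "(2 - x - 2 * y)\<^sup>2 + (2 - 2 * x - y)\<^sup>2 = (3 - 2 * x - 2 * y)\<^sup>2"
    using P(2) by algebra
  then have "(\<bar>2 - x - 2 * y\<bar> / (3 - 2 * x - 2 * y))\<^sup>2 + (\<bar>2 - 2 * x - y\<bar> / (3 - 2 * x - 2 * y))\<^sup>2 = 1"
    using pos by (simp add: power_divide flip: add_divide_distrib)
  then show ?thesis
    using pos by (simp add: romik_def P quarter_circle_def)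
qed

section \<open>Pulling the pairing back along the orbit of a point\<close>

lemma romik_funpow_quarter_circle:
  assumes "P \<in> quarter_circle"
  shows "(romik ^^ k) P \<in> quarter_circle"
  by (induction k) (simp_all add: assms romik_quarter_circle)

text \<open>The matrix preserves the form, so it moves to the other argument as its inverse, which
  sends \<open>(x, y, 1)\<close> to \<open>3 - 2 * x - 2 * y\<close> times the vector of
  \<open>romik P\<close>. The digit determines how the absolute values in \<open>romik\<close>
  open.\<close>

lemma pairing_romik_matrix:
  assumes "P \<in> quarter_circle"
  shows "pairing P (romik_matrix (romik_digit P) *v v) =
    (3 - 2 * fst P - 2 * snd P) * pairing (romik P) v"
proof -
  obtain x y where P: "P = (x, y)" "x\<^sup>2 + y\<^sup>2 = 1"
    using assms by (auto simp: quarter_circle_def)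
  define m where "m = 3 - 2 * x - 2 * y"
  have pos: "m > 0" unfolding m_def using P(2) by (rule romik_denominator_pos)
  have "m * pairing (romik P) v = m * of_int (v$3) - \<bar>2 - x - 2 * y\<bar> * of_int (v$1) - \<bar>2 - 2 * x - y\<bar> * of_int (v$2)"
    using pos by (simp add: pairing_def P romik_def right_diff_distrib flip: m_def)
  moreover note arc = romik_digit_arc[OF assms[unfolded P]]
  ultimately show ?thesis
  proof (cases rule: romik_digit_cases[of P])
    case 1
    then have "\<bar>2 - x - 2 * y\<bar> = 2 - x - 2 * y" "\<bar>2 - 2 * x - y\<bar> = 2 * x + y - 2"
      using arc(1) P by auto
    with \<open>m * _ = _\<close> 1 show ?thesis
      by (simp add: pairing_def P m_def romik_matrix_vector[unfolded One_nat_def] algebra_simps)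
  next
    case 2
    then have "\<bar>2 - x - 2 * y\<bar> = x + 2 * y - 2" "\<bar>2 - 2 * x - y\<bar> = 2 * x + y - 2"
      using arc(2) P by auto
    with \<open>m * _ = _\<close> 2 show ?thesis
      by (simp add: pairing_def P m_def romik_matrix_vector algebra_simps)
  next
    case 3
    then have "\<bar>2 - x - 2 * y\<bar> = x + 2 * y - 2" "\<bar>2 - 2 * x - y\<bar> = 2 - 2 * x - y"
      using arc(3) P by auto
    with \<open>m * _ = _\<close> 3 show ?thesis
      by (simp add: pairing_def P m_def romik_matrix_vector algebra_simps)
  qed
qed

text \<open>The factor \<open>l\<close> is the same for all \<open>v\<close> and nonnegative, so
  inequalities between pulled-back pairings transfer to \<open>P\<close>.\<close>

lemma pairing_romik_product:
  assumes "P \<in> quarter_circle"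
  obtains l where "l \<ge> 0"
    "\<And>v. pairing P (romik_product (romik_expansion P) k *v v) = l * pairing ((romik ^^ k) P) v"
proof -
  have "\<exists>l\<ge>0. \<forall>v. pairing P (romik_product (romik_expansion P) k *v v) = l * pairing ((romik ^^ k) P) v"
  proof (induction k)
    case 0
    show ?case by (intro exI[of _ 1]) simp
  next
    case (Suc k)
    then obtain l where l: "l \<ge> 0"
      "\<And>v. pairing P (romik_product (romik_expansion P) k *v v) = l * pairing ((romik ^^ k) P) v"
      by blast
    let ?Q = "(romik ^^ k) P"
    have Q: "?Q \<in> quarter_circle" by (rule romik_funpow_quarter_circle[OF assms])
    then have pos: "3 - 2 * fst ?Q - 2 * snd ?Q > 0"
      by (intro romik_denominator_pos) (auto simp: quarter_circle_def)
    have "pairing P (romik_product (romik_expansion P) (Suc k) *v v)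
        = (l * (3 - 2 * fst ?Q - 2 * snd ?Q)) * pairing ((romik ^^ Suc k) P) v" for v
      using pairing_romik_matrix[OF Q] l(2)
      by (simp add: romik_expansion_def flip: matrix_vector_mul_assoc)
    moreover have "l * (3 - 2 * fst ?Q - 2 * snd ?Q) \<ge> 0" using l(1) pos by simp
    ultimately show ?case by blast
  qed
  then show thesis using that by blast
qed

text \<open>These three combinations are the coefficients of the height in the spinor coordinates.\<close>

lemma romik_product_row:
  fixes P k
  defines "r \<equiv> romik_product (romik_expansion P) k $ 3"
  shows "r $ 1 + r $ 3 \<ge> 0 \<and> r $ 2 + r $ 3 \<ge> 0 \<and> r $ 1 + r $ 2 + r $ 3 \<ge> 0"
  unfolding r_def
proof (induction k)
  case 0
  show ?case by (simp add: mat_def)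
next
  case (Suc k)
  let ?Q = "(romik ^^ k) P"
  have *: "romik_product (romik_expansion P) (Suc k)
      = romik_product (romik_expansion P) k ** romik_matrix (romik_digit ?Q)"
    by (simp add: romik_expansion_def)
  \<comment> \<open>For each matrix, the three new combinations are nonnegative integer combinations
    of the three old ones.\<close>
  show ?case
    using Suc unfolding *
    by (cases rule: romik_digit_cases[of ?Q])
      (simp_all add: matrix_matrix_mult_def sum_3 romik_matrix_def)
qed

section \<open>Spinor coordinates\<close>

text \<open>On the cone \<open>(a + b - c)\<^sup>2 = 2 * (c - b) * (c - a)\<close> and
  \<open>a + b - c\<close> is nonnegative, so taking roots gives the mixed relation. It serves both
  the integer triple and \<open>(x, y, 1)\<close>.\<close>

lemma spinor:
  fixes a b c :: real
  assumes "a \<ge> 0" "b \<ge> 0" "c > 0" "a\<^sup>2 + b\<^sup>2 = c\<^sup>2"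
  obtains X Y where "X \<ge> 0" "Y \<ge> 0" "c - b = X\<^sup>2" "c - a = Y\<^sup>2" "a + b - c = sqrt 2 * X * Y"
proof -
  have "a\<^sup>2 \<le> c\<^sup>2" "b\<^sup>2 \<le> c\<^sup>2" using assms(4) by (smt (verit) zero_le_power2)+
  then have le: "a \<le> c" "b \<le> c" using assms(3) by (auto intro: power2_le_imp_le)
  have "c\<^sup>2 \<le> (a + b)\<^sup>2" using assms by (simp add: power2_sum)
  then have "c \<le> a + b" using assms by (auto intro: power2_le_imp_le)
  moreover have "(a + b - c)\<^sup>2 = 2 * (c - b) * (c - a)" using assms(4) by algebra
  ultimately have "a + b - c = sqrt (2 * (c - b) * (c - a))"
    by (metis diff_ge_0_iff_ge real_sqrt_unique)
  then have "a + b - c = sqrt 2 * sqrt (c - b) * sqrt (c - a)"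
    by (simp only: real_sqrt_mult)
  then show thesis using that[of "sqrt (c - b)" "sqrt (c - a)"] le by simp
qed

text \<open>The ratio \<open>U / V\<close> lies between \<open>X / Y\<close> and
  \<open>s / t\<close>, and \<open>(U, V)\<close> is coordinatewise at most \<open>(X, Y)\<close>.
  Hence both the quadratic form and the absolute value of the determinant are smaller at
  \<open>(U, V)\<close>.\<close>

lemma spinor_separated:
  fixes A B C X Y U V s t :: real
  assumes "A \<ge> 0" "B \<ge> 0" "C \<ge> 0" "0 \<le> U" "0 < V" "U \<le> X" "V \<le> Y" "0 \<le> s" "0 \<le> t"
    and "X * V \<le> U * Y" "U * t \<le> V * s"
  shows "(A * U\<^sup>2 + B * V\<^sup>2 + C * (U * V)) * (U * t - V * s)\<^sup>2
       \<le> (A * X\<^sup>2 + B * Y\<^sup>2 + C * (X * Y)) * (X * t - Y * s)\<^sup>2"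
proof (rule mult_mono)
  show "A * U\<^sup>2 + B * V\<^sup>2 + C * (U * V) \<le> A * X\<^sup>2 + B * Y\<^sup>2 + C * (X * Y)"
    using assms by (intro add_mono mult_left_mono power_mono mult_mono) auto
  \<comment> \<open>The determinant grows by \<open>(Y - V) * s - (X - U) * t\<close>; multiplying
    by \<open>V\<close> lets the two ratio hypotheses show that this is nonnegative.\<close>
  have "V * ((X - U) * t) \<le> (Y - V) * (U * t)"
  proof -
    have "(X * V) * t \<le> (U * Y) * t" using assms by (intro mult_right_mono) auto
    then show ?thesis by (simp add: algebra_simps)
  qed
  also have "\<dots> \<le> (Y - V) * (V * s)" using assms by (intro mult_left_mono) auto
  finally have "V * ((X - U) * t) \<le> V * ((Y - V) * s)" by (simp add: algebra_simps)
  then have "(X - U) * t \<le> (Y - V) * s" using assms(5) by (simp add: mult_le_cancel_left)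
  then have "V * s - U * t \<le> Y * s - X * t" by (simp add: algebra_simps)
  then have "(V * s - U * t)\<^sup>2 \<le> (Y * s - X * t)\<^sup>2" using assms(11) by (intro power_mono) auto
  then show "(U * t - V * s)\<^sup>2 \<le> (X * t - Y * s)\<^sup>2" by (simp add: power2_commute)
qed (use assms in auto)

text \<open>Compares the spinor \<open>(1, Y)\<close> with \<open>(0, 1)\<close>, the spinor of
  \<open>(0, 1, 1)\<close>. The \<open>B\<close> term alone suffices, since
  \<open>Y * (Y * s - t)\<close> is at least its value at \<open>Y = sqrt 2\<close>, which is at
  least \<open>s\<close>.\<close>

lemma spinor_fallback:
  fixes A B C Y s t :: real
  assumes "A \<ge> 0" "B \<ge> 0" "C \<ge> 0" "sqrt 2 \<le> Y" "0 \<le> s" "0 \<le> t" "sqrt 2 * t \<le> s"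
  shows "B * s\<^sup>2 \<le> (A + B * Y\<^sup>2 + C * Y) * (t - Y * s)\<^sup>2"
proof -
  have "sqrt 2 * sqrt 2 = 2" by simp
  then have "s \<le> 2 * s - sqrt 2 * t" using assms by linarith
  also have "\<dots> = sqrt 2 * (sqrt 2 * s - t)" using \<open>sqrt 2 * sqrt 2 = 2\<close> by (simp add: right_diff_distrib)
  also have "\<dots> \<le> Y * (Y * s - t)"
  proof (rule mult_mono)
    show "sqrt 2 * s - t \<le> Y * s - t" using assms by (simp add: mult_right_mono)
    have "t \<le> sqrt 2 * t" using assms by (simp add: mult_le_cancel_right1)
    moreover have "s \<le> sqrt 2 * s" using assms by (simp add: mult_le_cancel_right1)
    ultimately show "0 \<le> sqrt 2 * s - t" using assms by linarith
  qed (use assms in \<open>auto intro: order_trans[of _ "sqrt 2"]\<close>)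
  finally have "s\<^sup>2 \<le> (Y * (Y * s - t))\<^sup>2" using assms by (intro power_mono) auto
  then have "B * s\<^sup>2 \<le> B * (Y * (Y * s - t))\<^sup>2" using assms by (intro mult_left_mono) auto
  also have "\<dots> = (B * Y\<^sup>2) * (t - Y * s)\<^sup>2" by algebra
  also have "\<dots> \<le> (A + B * Y\<^sup>2 + C * Y) * (t - Y * s)\<^sup>2"
  proof (rule mult_right_mono)
    have "0 \<le> Y" using assms(4) by (rule order_trans[rotated]) simp
    then have "0 \<le> A + C * Y" using assms by simp
    then show "B * Y\<^sup>2 \<le> A + B * Y\<^sup>2 + C * Y" by simp
  qed simp
  finally show ?thesis .
qed

section \<open>Comparing a triple with endpoints that separate it from the point\<close>

context
  fixes f1 f2 f3 x y :: real and a b c :: int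
  assumes row: "f1 + f3 \<ge> 0" "f2 + f3 \<ge> 0" "f1 + f2 + f3 \<ge> 0"
    and xy: "x \<ge> 0" "y \<ge> 0" "x\<^sup>2 + y\<^sup>2 = 1"
    and abc: "a > 0" "b > 0" "c > 0" "a\<^sup>2 + b\<^sup>2 = c\<^sup>2"
begin

text \<open>Here \<open>f1\<close>, \<open>f2\<close>, \<open>f3\<close> stand for the bottom row of
  the matrix product and \<open>(x, y)\<close> for an iterate of \<open>P\<close>; up to a common
  factor, \<open>q\<close> is the squared \<open>delta\<close> of a reduced triple.\<close>

private definition q :: "real \<Rightarrow> real \<Rightarrow> real \<Rightarrow> real" where
  "q u v w = (f1 * u + f2 * v + f3 * w) * (w - x * u - y * v)"

text \<open>Puts \<open>q\<close> into the shape required by \<open>spinor_separated\<close>. The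
  triple \<open>(4, 3, 5)\<close> has spinor \<open>(sqrt 2, 1)\<close>, and
  \<open>(0, 1, 1)\<close> has spinor \<open>(0, 1)\<close>.\<close>

private lemma spinor_ex:
  obtains X Y s t :: real where "X \<ge> 1" "Y \<ge> 1" "s \<ge> 0" "t \<ge> 0" "real_of_int c - of_int b = X\<^sup>2" "real_of_int c - of_int a = Y\<^sup>2"
    "1 - y = s\<^sup>2" "1 - x = t\<^sup>2" "x + y - 1 = sqrt 2 * s * t" "real_of_int a + of_int b - of_int c = sqrt 2 * X * Y"
    "q a b c = ((f1 + f3) * X\<^sup>2 + (f2 + f3) * Y\<^sup>2 + sqrt 2 * (f1 + f2 + f3) * (X * Y)) * (X * t - Y * s)\<^sup>2"
    "q 4 3 5 = ((f1 + f3) * (sqrt 2)\<^sup>2 + (f2 + f3) * 1\<^sup>2 + sqrt 2 * (f1 + f2 + f3) * (sqrt 2 * 1)) * (sqrt 2 * t - 1 * s)\<^sup>2"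
    "q 0 1 1 = (f2 + f3) * s\<^sup>2"
proof -
  have abc': "real_of_int a \<ge> 0" "real_of_int b \<ge> 0" "real_of_int c > 0"
    "(real_of_int a)\<^sup>2 + (real_of_int b)\<^sup>2 = (real_of_int c)\<^sup>2"
    using abc by (auto simp flip: of_int_power of_int_add)
  obtain X Y where X: "X \<ge> 0" "Y \<ge> 0" "real_of_int c - of_int b = X\<^sup>2" "real_of_int c - of_int a = Y\<^sup>2" "real_of_int a + of_int b - of_int c = sqrt 2 * X * Y"
    using spinor[OF abc'] by metis
  obtain s t where s: "s \<ge> 0" "t \<ge> 0" "1 - y = s\<^sup>2" "1 - x = t\<^sup>2" "x + y - 1 = sqrt 2 * s * t"
    using spinor[of x y 1] xy by (metis one_power2 zero_less_one)
  \<comment> \<open>Positive legs make \<open>c - a\<close> and \<open>c - b\<close> positive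
    integers, whence \<open>X\<close> and \<open>Y\<close> are at least 1.\<close>
  have lt: "a < c" "b < c"
    using abc by (smt (verit) power2_less_imp_less zero_less_power2)+
  have "X\<^sup>2 \<ge> 1" "Y\<^sup>2 \<ge> 1" using lt X(3,4) by linarith+
  then have XY: "X \<ge> 1" "Y \<ge> 1" using X by (metis one_power2 power2_le_imp_le)+
  have e: "real_of_int a = X\<^sup>2 + sqrt 2 * X * Y" "real_of_int b = Y\<^sup>2 + sqrt 2 * X * Y" "real_of_int c = X\<^sup>2 + Y\<^sup>2 + sqrt 2 * X * Y"
    using X by linarith+
  have "c - x * a - y * b = (1 - x) * X\<^sup>2 + (1 - y) * Y\<^sup>2 - (x + y - 1) * (sqrt 2 * X * Y)"
    unfolding e by (simp add: algebra_simps)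
  also have "\<dots> = t\<^sup>2 * X\<^sup>2 + s\<^sup>2 * Y\<^sup>2 - (sqrt 2 * s * t) * (sqrt 2 * X * Y)"
    unfolding s(3-5) ..
  also have "\<dots> = (X * t - Y * s)\<^sup>2"
    by (simp add: power2_eq_square algebra_simps)
  finally have D: "c - x * a - y * b = (X * t - Y * s)\<^sup>2" .
  have "f1 * a + f2 * b + f3 * c = (f1 + f3) * X\<^sup>2 + (f2 + f3) * Y\<^sup>2 + sqrt 2 * (f1 + f2 + f3) * (X * Y)"
    unfolding e by (simp add: algebra_simps)
  with D have "q a b c = ((f1 + f3) * X\<^sup>2 + (f2 + f3) * Y\<^sup>2 + sqrt 2 * (f1 + f2 + f3) * (X * Y)) * (X * t - Y * s)\<^sup>2"
    unfolding q_def by simp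
  moreover have "q 4 3 5 = ((f1 + f3) * (sqrt 2)\<^sup>2 + (f2 + f3) * 1\<^sup>2 + sqrt 2 * (f1 + f2 + f3) * (sqrt 2 * 1)) * (sqrt 2 * t - 1 * s)\<^sup>2"
  proof -
    have "(sqrt 2 * t - 1 * s)\<^sup>2 = 2 * t\<^sup>2 + s\<^sup>2 - 2 * (sqrt 2 * s * t)"
      by (simp add: power2_diff power_mult_distrib)
    also have "\<dots> = 5 - x * 4 - y * 3" unfolding s(3-5)[symmetric] by simp
    finally have 1: "(sqrt 2 * t - 1 * s)\<^sup>2 = 5 - x * 4 - y * 3" .
    have "sqrt 2 * (f1 + f2 + f3) * (sqrt 2 * 1) = (sqrt 2 * sqrt 2) * (f1 + f2 + f3)"
      by (simp only: ac_simps mult_1_right)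
    then have 2: "(f1 + f3) * (sqrt 2)\<^sup>2 + (f2 + f3) * 1\<^sup>2 + sqrt 2 * (f1 + f2 + f3) * (sqrt 2 * 1) = f1 * 4 + f2 * 3 + f3 * 5"
      by simp
    show ?thesis unfolding 1 2 q_def ..
  qed
  moreover have "q 0 1 1 = (f2 + f3) * s\<^sup>2" unfolding q_def s(3)[symmetric] by simp
  ultimately show thesis by (rule that[OF XY s(1,2) X(3,4) s(3-5) X(5)])
qed

text \<open>The chord through \<open>(0, 1)\<close> and \<open>(4/5, 3/5)\<close> separates the
  triple from \<open>(x, y)\<close>. If \<open>X\<close> is at least \<open>sqrt 2\<close>, the
  endpoint \<open>(4, 3, 5)\<close> wins by \<open>spinor_separated\<close>; otherwise
  \<open>X = 1\<close> and \<open>(0, 1, 1)\<close> wins by \<open>spinor_fallback\<close>.\<close>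

lemma better_endpoint_left:
  assumes "x + 2 * y \<le> 2" "2 * x + y \<ge> 2" "a + 2 * b > 2 * c"
  shows "(f1 * 4 + f2 * 3 + f3 * 5) * (5 - x * 4 - y * 3) \<le> (f1 * a + f2 * b + f3 * c) * (c - x * a - y * b)
       \<or> (f2 + f3) * (1 - y) \<le> (f1 * a + f2 * b + f3 * c) * (c - x * a - y * b)"
proof -
  obtain X Y s t where H: "X \<ge> 1" "Y \<ge> 1" "s \<ge> 0" "t \<ge> 0" "real_of_int c - of_int b = X\<^sup>2" "real_of_int c - of_int a = Y\<^sup>2"
    "1 - y = s\<^sup>2" "1 - x = t\<^sup>2" "x + y - 1 = sqrt 2 * s * t" "real_of_int a + of_int b - of_int c = sqrt 2 * X * Y"
    and Q: "q a b c = ((f1 + f3) * X\<^sup>2 + (f2 + f3) * Y\<^sup>2 + sqrt 2 * (f1 + f2 + f3) * (X * Y)) * (X * t - Y * s)\<^sup>2"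
    "q 4 3 5 = ((f1 + f3) * (sqrt 2)\<^sup>2 + (f2 + f3) * 1\<^sup>2 + sqrt 2 * (f1 + f2 + f3) * (sqrt 2 * 1)) * (sqrt 2 * t - 1 * s)\<^sup>2"
    "q 0 1 1 = (f2 + f3) * s\<^sup>2"
    by (rule spinor_ex)
  \<comment> \<open>In spinors the chord condition compares \<open>X / Y\<close> with
    \<open>sqrt 2\<close>, the ratio of \<open>(4, 3, 5)\<close>; likewise \<open>s / t\<close>
    below.\<close>
  have "X * (sqrt 2 * Y - X) > 0"
  proof -
    have "X * (sqrt 2 * Y - X) = sqrt 2 * X * Y - X\<^sup>2" by algebra
    also have "\<dots> = real_of_int (a + 2 * b - 2 * c)" using H(5,10) by simp
    also have "\<dots> > 0" using assms(3) by linarith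
    finally show ?thesis .
  qed
  then have XY: "X < sqrt 2 * Y" using H(1) by (simp add: zero_less_mult_iff)
  have "s * (s - sqrt 2 * t) = s\<^sup>2 - sqrt 2 * s * t" by algebra
  also have "\<dots> = 2 - x - 2 * y" using H(7,9) by linarith
  finally have "s * (s - sqrt 2 * t) \<ge> 0" using assms(1) by simp
  moreover have "s > 0"
  proof (rule ccontr)
    assume "\<not> s > 0"
    with H(3,7) have "y = 1" by simp
    with xy assms show False by simp
  qed
  ultimately have st: "sqrt 2 * t \<le> s" by (simp add: zero_le_mult_iff)
  show ?thesis
  proof (cases "c - b \<ge> 2")
    case True
    then have "X\<^sup>2 \<ge> 2" using H(5) by linarith
    then have "sqrt 2 \<le> X" using H(1) by (intro real_le_lsqrt) simp_all
    then have "q 4 3 5 \<le> q a b c"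
      unfolding Q using row H(1-4) st XY by (intro spinor_separated) auto
    then show ?thesis by (simp add: q_def)
  next
    case False
    have "X\<^sup>2 \<ge> 1" using H(1) by simp
    with False H(5) have cb: "c - b = 1" by linarith
    with H(5) have "X\<^sup>2 = 1\<^sup>2" unfolding one_power2 by linarith
    then have X1: "X = 1" using H(1) by (simp add: power2_eq_1_iff)
    \<comment> \<open>If both differences were 1, then \<open>(a + b - c)\<^sup>2\<close> would be
      2, which is not a square.\<close>
    have "c - a \<noteq> 1"
    proof
      assume "c - a = 1"
      with cb have "(a + b - c) * (a + b - c) = 2" using abc(4) by algebra
      moreover have "n * n \<noteq> 2" for n :: int
      proof -
        have "\<bar>n\<bar> \<le> 1 \<or> \<bar>n\<bar> \<ge> 2" by linarith
        then have "n * n \<le> 1 \<or> n * n \<ge> 4"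
          using abs_le_square_iff[of n 1] abs_le_square_iff[of 2 n] by (auto simp: power2_eq_square)
        then show ?thesis by auto
      qed
      ultimately show False by blast
    qed
    moreover have "Y\<^sup>2 \<ge> 1" using H(2) by simp
    ultimately have "Y\<^sup>2 \<ge> 2" using H(6) by linarith
    then have "sqrt 2 \<le> Y" using H(2) by (intro real_le_lsqrt) simp_all
    then have "q 0 1 1 \<le> q a b c"
      unfolding Q X1 using row H(1-4) st
        spinor_fallback[of "f1 + f3" "f2 + f3" "sqrt 2 * (f1 + f2 + f3)" Y s t] by simp
    then show ?thesis by (simp add: q_def)
  qed
qed

text \<open>On this side \<open>X > sqrt 2 * Y\<close> already forces \<open>X\<close> to be at
  least \<open>sqrt 2\<close>, so \<open>spinor_separated\<close>, with the two coordinates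
  exchanged, covers every case.\<close>

lemma better_endpoint_right:
  assumes "x + 2 * y \<ge> 2" "a + 2 * b < 2 * c"
  shows "(f1 * 4 + f2 * 3 + f3 * 5) * (5 - x * 4 - y * 3) \<le> (f1 * a + f2 * b + f3 * c) * (c - x * a - y * b)"
proof -
  obtain X Y s t where H: "X \<ge> 1" "Y \<ge> 1" "s \<ge> 0" "t \<ge> 0" "real_of_int c - of_int b = X\<^sup>2" "real_of_int c - of_int a = Y\<^sup>2"
    "1 - y = s\<^sup>2" "1 - x = t\<^sup>2" "x + y - 1 = sqrt 2 * s * t" "real_of_int a + of_int b - of_int c = sqrt 2 * X * Y"
    and Q: "q a b c = ((f1 + f3) * X\<^sup>2 + (f2 + f3) * Y\<^sup>2 + sqrt 2 * (f1 + f2 + f3) * (X * Y)) * (X * t - Y * s)\<^sup>2"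
    "q 4 3 5 = ((f1 + f3) * (sqrt 2)\<^sup>2 + (f2 + f3) * 1\<^sup>2 + sqrt 2 * (f1 + f2 + f3) * (sqrt 2 * 1)) * (sqrt 2 * t - 1 * s)\<^sup>2"
    "q 0 1 1 = (f2 + f3) * s\<^sup>2"
    by (rule spinor_ex)
  have "X * (X - sqrt 2 * Y) > 0"
  proof -
    have "X * (X - sqrt 2 * Y) = X\<^sup>2 - sqrt 2 * X * Y" by algebra
    also have "\<dots> = real_of_int (2 * c - (a + 2 * b))" using H(5,10) by simp
    also have "\<dots> > 0" using assms(2) by linarith
    finally show ?thesis .
  qed
  then have XY: "sqrt 2 * Y < X" using H(1) by (simp add: zero_less_mult_iff)
  have "s * (sqrt 2 * t - s) = sqrt 2 * s * t - s\<^sup>2" by algebra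
  also have "\<dots> = x + 2 * y - 2" using H(7,9) by linarith
  finally have "s * (sqrt 2 * t - s) \<ge> 0" using assms(1) by simp
  then have st: "s \<le> sqrt 2 * t" using H(3,4) by (auto simp: zero_le_mult_iff)
  have "sqrt 2 \<le> sqrt 2 * Y" using H(2) by simp
  with XY have "sqrt 2 \<le> X" by linarith
  then have "((f2 + f3) * 1\<^sup>2 + (f1 + f3) * (sqrt 2)\<^sup>2 + sqrt 2 * (f1 + f2 + f3) * (1 * sqrt 2)) * (1 * s - sqrt 2 * t)\<^sup>2
    \<le> ((f2 + f3) * Y\<^sup>2 + (f1 + f3) * X\<^sup>2 + sqrt 2 * (f1 + f2 + f3) * (Y * X)) * (Y * s - X * t)\<^sup>2"
    using row H(1-4) st XY by (intro spinor_separated) (auto simp: mult.commute)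
  then have "q 4 3 5 \<le> q a b c"
    unfolding Q power2_commute[of "1 * s"] power2_commute[of "Y * s"] by (simp only: ac_simps)
  then show ?thesis by (simp add: q_def)
qed

end

section \<open>Descent along the digits\<close>

lemma point_of_triple_scale:
  assumes "c \<noteq> 0"
  shows "point_of_triple (c *s v) = point_of_triple v"
  using assms by (simp add: point_of_triple_def)

text \<open>This number is the last entry of the preimage of \<open>z\<close> under each of the
  three matrices.\<close>

lemma light_denominator_pos:
  assumes "light z"
  shows "3 * z $ 3 - 2 * z $ 1 - 2 * z $ 2 > 0"
proof -
  let ?x = "real_of_int (z $ 1) / of_int (z $ 3)" and ?y = "real_of_int (z $ 2) / of_int (z $ 3)"
  have "(real_of_int (z $ 1))\<^sup>2 + (of_int (z $ 2))\<^sup>2 = (of_int (z $ 3))\<^sup>2" and p: "real_of_int (z $ 3) > 0"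
    using assms by (auto simp: light_def simp flip: of_int_power of_int_add)
  then have "?x\<^sup>2 + ?y\<^sup>2 = 1" by (simp add: power_divide flip: add_divide_distrib)
  from romik_denominator_pos[OF this]
  have "0 < real_of_int (z $ 3) * (3 - 2 * ?x - 2 * ?y)" using p by simp
  also have "\<dots> = real_of_int (3 * z $ 3 - 2 * z $ 1 - 2 * z $ 2)"
    using p by (simp add: field_simps)
  finally show ?thesis by linarith
qed

text \<open>The hypothesis forces \<open>a / c\<close> to be at least \<open>4/5\<close>, hence at
  least \<open>3/5\<close>, which puts the triple on the stated side of the other chord.\<close>

lemma arcs_disjoint:
  fixes a b c :: int
  assumes "a > 0" "b > 0" "c > 0" "a\<^sup>2 + b\<^sup>2 = c\<^sup>2" "a + 2 * b \<le> 2 * c"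
  shows "2 * a + b \<ge> 2 * c"
proof -
  have "a\<^sup>2 \<le> c\<^sup>2" using assms(4) zero_le_power2[of b] by linarith
  then have "a \<le> c" by (rule power2_le_imp_le) (use assms(3) in simp)
  have "(2 * b)\<^sup>2 \<le> (2 * c - a)\<^sup>2" by (rule power_mono) (use assms in simp_all)
  moreover have "a * (5 * a - 4 * c) = (2 * c - a)\<^sup>2 - (2 * b)\<^sup>2" using assms(4) by algebra
  ultimately have "a * (5 * a - 4 * c) \<ge> 0" by simp
  then have "5 * a \<ge> 4 * c" using assms(1) by (simp add: zero_le_mult_iff)
  then have "(c - a) * (5 * a - 3 * c) \<ge> 0"
    using assms(3) \<open>a \<le> c\<close> by (intro mult_nonneg_nonneg) simp_all
  moreover have "(c - a) * (5 * a - 3 * c) = b\<^sup>2 - (2 * c - 2 * a)\<^sup>2" using assms(4) by algebra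
  ultimately have "(2 * c - 2 * a)\<^sup>2 \<le> b\<^sup>2" by simp
  then have "2 * c - 2 * a \<le> b" by (rule power2_le_imp_le) (use assms(2) in simp)
  then show ?thesis by simp
qed

text \<open>The chord inequalities make the legs of the inverse image nonnegative. Its last entry
  drops because \<open>z $ 3 < z $ 1 + z $ 2\<close> when both legs are positive.\<close>

lemma light_preimage:
  assumes "light z" "z $ 1 > 0" "z $ 2 > 0"
    and "d = 1 \<and> z$1 + 2 * z$2 \<le> 2 * z$3
       \<or> d = 2 \<and> z$1 + 2 * z$2 \<ge> 2 * z$3 \<and> 2 * z$1 + z$2 \<ge> 2 * z$3
       \<or> d = 3 \<and> 2 * z$1 + z$2 \<le> 2 * z$3"
  obtains w where "light w" "w $ 3 < z $ 3" "romik_matrix d *v w = z"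
proof -
  have sq: "(z $ 1)\<^sup>2 + (z $ 2)\<^sup>2 = (z $ 3)\<^sup>2" and "z $ 3 > 0"
    using assms by (auto simp: light_def)
  note pos = light_denominator_pos[OF assms(1)]
  have "(z $ 3)\<^sup>2 < (z $ 1 + z $ 2)\<^sup>2" using assms sq by (simp add: power2_sum)
  then have lt: "z $ 3 < z $ 1 + z $ 2" by (rule power2_less_imp_less) (use assms in simp)
  show thesis
    using assms(4)
  proof (elim disjE conjE)
    assume d: "d = 1" and le: "z$1 + 2 * z$2 \<le> 2 * z$3"
    have "2 * z$1 + z$2 \<ge> 2 * z$3"
      using arcs_disjoint[OF assms(2,3) \<open>z$3 > 0\<close> sq le] .
    \<comment> \<open>The witness is the inverse matrix applied to \<open>z\<close>; the inverse is
      \<open>J M^T J\<close> with \<open>J = diag(1, 1, -1)\<close>, as for any matrix preserving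
      the form.\<close>
    moreover have "(- z$1 - 2 * z$2 + 2 * z$3)\<^sup>2 + (2 * z$1 + z$2 - 2 * z$3)\<^sup>2 = (- 2 * z$1 - 2 * z$2 + 3 * z$3)\<^sup>2"
      using sq by algebra
    ultimately show thesis
      using d le lt pos
      by (intro that[of "vector [- z$1 - 2 * z$2 + 2 * z$3, 2 * z$1 + z$2 - 2 * z$3, - 2 * z$1 - 2 * z$2 + 3 * z$3]"])
        (auto simp: light_def romik_matrix_vector[unfolded One_nat_def] vec_eq_iff forall_3)
  next
    assume d: "d = 2" and le: "z$1 + 2 * z$2 \<ge> 2 * z$3" "2 * z$1 + z$2 \<ge> 2 * z$3"
    have "(z$1 + 2 * z$2 - 2 * z$3)\<^sup>2 + (2 * z$1 + z$2 - 2 * z$3)\<^sup>2 = (- 2 * z$1 - 2 * z$2 + 3 * z$3)\<^sup>2"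
      using sq by algebra
    then show thesis
      using d le lt pos
      by (intro that[of "vector [z$1 + 2 * z$2 - 2 * z$3, 2 * z$1 + z$2 - 2 * z$3, - 2 * z$1 - 2 * z$2 + 3 * z$3]"])
        (auto simp: light_def romik_matrix_vector vec_eq_iff forall_3)
  next
    assume d: "d = 3" and le: "2 * z$1 + z$2 \<le> 2 * z$3"
    have "z$1 + 2 * z$2 \<ge> 2 * z$3"
      using arcs_disjoint[OF assms(3,2) \<open>z$3 > 0\<close>] sq le by (simp add: add.commute)
    moreover have "(z$1 + 2 * z$2 - 2 * z$3)\<^sup>2 + (- 2 * z$1 - z$2 + 2 * z$3)\<^sup>2 = (- 2 * z$1 - 2 * z$2 + 3 * z$3)\<^sup>2"
      using sq by algebra
    ultimately show thesis
      using d le lt pos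
      by (intro that[of "vector [z$1 + 2 * z$2 - 2 * z$3, - 2 * z$1 - z$2 + 2 * z$3, - 2 * z$1 - 2 * z$2 + 3 * z$3]"])
        (auto simp: light_def romik_matrix_vector vec_eq_iff forall_3)
  qed
qed

text \<open>A digit of \<open>P\<close> separates \<open>z\<close> from the iterate
  \<open>Q\<close>. The comparison is made at \<open>Q\<close> and carried back to \<open>P\<close>
  by the matrix product.\<close>

lemma separated_better_endpoint:
  fixes P :: "real \<times> real" and k :: nat and z :: "int^3"
  defines "N \<equiv> romik_product (romik_expansion P) k" and "Q \<equiv> (romik ^^ k) P"
  assumes P: "P \<in> quarter_circle" and z: "light z" "z $ 1 > 0" "z $ 2 > 0"
    and ht: "Ht (point_of_triple (N *v z)) = (N *v z) $ 3"
    and out: "romik_digit Q = 1 \<and> z$1 + 2 * z$2 > 2 * z$3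
       \<or> romik_digit Q = 2 \<and> (z$1 + 2 * z$2 < 2 * z$3 \<or> 2 * z$1 + z$2 < 2 * z$3)
       \<or> romik_digit Q = 3 \<and> 2 * z$1 + z$2 > 2 * z$3"
  shows "\<exists>j. min (delta P (Z10 j P)) (delta P (Z01 j P)) \<le> delta P (point_of_triple (N *v z))"
proof -
  define f1 f2 f3 where "f1 = real_of_int (N $ 3 $ 1)" "f2 = real_of_int (N $ 3 $ 2)" "f3 = real_of_int (N $ 3 $ 3)"
  have row: "f1 + f3 \<ge> 0" "f2 + f3 \<ge> 0" "f1 + f2 + f3 \<ge> 0" "f2 + f1 + f3 \<ge> 0"
    using romik_product_row[of P k] unfolding f1_f2_f3_def N_def by linarith+
  have Qc: "Q \<in> quarter_circle" unfolding Q_def by (rule romik_funpow_quarter_circle[OF P])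
  then obtain x y where Q: "Q = (x, y)" "x \<ge> 0" "y \<ge> 0" "x\<^sup>2 + y\<^sup>2 = 1" "y\<^sup>2 + x\<^sup>2 = 1"
    by (auto simp: quarter_circle_def)
  note arc = romik_digit_arc[OF Qc[unfolded Q(1)], folded Q(1)]
  obtain l where l: "l \<ge> 0" "\<And>v. pairing P (N *v v) = l * pairing Q v"
    unfolding N_def Q_def using pairing_romik_product[OF P] by metis
  have N3: "real_of_int ((N *v v) $ 3) = f1 * of_int (v$1) + f2 * of_int (v$2) + f3 * of_int (v$3)" for v
    by (simp add: f1_f2_f3_def matrix_vector_mult_def sum_3)
  \<comment> \<open>This is the product to be compared, without the common factor
    \<open>l\<close>.\<close>
  define g where "g v = real_of_int ((N *v v) $ 3) * pairing Q v" for v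
  have g_eq: "g (vector [a, b, c]) = (f1 * of_int a + f2 * of_int b + f3 * of_int c) * (of_int c - x * of_int a - y * of_int b)" for a b c
    by (simp add: g_def N3 pairing_def Q)
  have gz: "g z = (f1 * of_int (z$1) + f2 * of_int (z$2) + f3 * of_int (z$3)) * (of_int (z$3) - x * of_int (z$1) - y * of_int (z$2))"
    by (simp add: g_def N3 pairing_def Q)
  have light_N: "light v \<Longrightarrow> light (N *v v)" for v
    unfolding N_def by (rule light_romik_product)
  have better: "delta P (point_of_triple (N *v w)) \<le> delta P (point_of_triple (N *v z))"
    if "light w" "g w \<le> g z" for w
  proof (rule delta_mono[OF P light_N[OF z(1)] light_N[OF that(1)] ht])
    have "l * g w \<le> l * g z" using that(2) l(1) by (rule mult_left_mono)
    then show "real_of_int ((N *v w) $ 3) * pairing P (N *v w) \<le> real_of_int ((N *v z) $ 3) * pairing P (N *v z)"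
      unfolding g_def l(2) by (simp add: mult.left_commute)
  qed
  have light_ex: "light (vector [0, 1, 1])" "light (vector [1, 0, 1])" "light (vector [4, 3, 5])" "light (vector [3, 4, 5])"
    by (simp_all add: light_def)
  have Suc_k: "romik_product (romik_expansion P) (Suc k) *v v = N *v (romik_matrix (romik_digit Q) *v v)" for v
    by (simp add: N_def Q_def romik_expansion_def flip: matrix_vector_mul_assoc)
  have cone: "z $ 3 > 0" "(z$1)\<^sup>2 + (z$2)\<^sup>2 = (z$3)\<^sup>2" "(z$2)\<^sup>2 + (z$1)\<^sup>2 = (z$3)\<^sup>2"
    using z(1) by (auto simp: light_def)
  \<comment> \<open>Neighbouring arcs share an endpoint: matrices 1 and 2 both send
    \<open>(0, 1, 1)\<close> to \<open>(4, 3, 5)\<close>, and matrices 2 and 3 both send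
    \<open>(1, 0, 1)\<close> to \<open>(3, 4, 5)\<close>.\<close>
  have Z01_435: "Z01 (Suc k) P = point_of_triple (N *v vector [4, 3, 5])" if "romik_digit Q = 1 \<or> romik_digit Q = 2"
    using that unfolding Z01_def Suc_k by (auto simp: romik_matrix_vector[unfolded One_nat_def])
  have Z10_345: "Z10 (Suc k) P = point_of_triple (N *v vector [3, 4, 5])" if "romik_digit Q = 2 \<or> romik_digit Q = 3"
    using that unfolding Z10_def Suc_k by (auto simp: romik_matrix_vector)
  have Zk: "Z01 k P = point_of_triple (N *v vector [0, 1, 1])" "Z10 k P = point_of_triple (N *v vector [1, 0, 1])"
    by (simp_all add: Z01_def Z10_def N_def)
  note left = better_endpoint_left[OF row(1-3) Q(2-4) z(2,3) cone(1,2)]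
  note right = better_endpoint_right[OF row(1-3) Q(2-4) z(2,3) cone(1,2)]
  \<comment> \<open>Reflection in the diagonal exchanges the coordinates of \<open>Q\<close>,
    \<open>z\<close> and the row, giving the comparison at \<open>(3, 4, 5)\<close>.\<close>
  note left' = better_endpoint_left[OF row(2,1,4) Q(3,2,5) z(3,2) cone(1,3)]
  note right' = better_endpoint_right[OF row(2,1,4) Q(3,2,5) z(3,2) cone(1,3)]
  consider (a) "romik_digit Q = 1" "z$1 + 2 * z$2 > 2 * z$3"
    | (b) "romik_digit Q = 2" "z$1 + 2 * z$2 < 2 * z$3"
    | (c) "romik_digit Q = 2" "2 * z$1 + z$2 < 2 * z$3"
    | (d) "romik_digit Q = 3" "2 * z$1 + z$2 > 2 * z$3"
    using out by blast
  then show ?thesis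
  proof cases
    case a
    then have "g (vector [4, 3, 5]) \<le> g z \<or> g (vector [0, 1, 1]) \<le> g z"
      using left arc(1) unfolding g_eq gz by simp
    then have "delta P (Z01 (Suc k) P) \<le> delta P (point_of_triple (N *v z))
      \<or> delta P (Z01 k P) \<le> delta P (point_of_triple (N *v z))"
      using better light_ex Z01_435 Zk a by metis
    then show ?thesis by (meson min.coboundedI2)
  next
    case b
    then have "g (vector [4, 3, 5]) \<le> g z"
      using right arc(2) unfolding g_eq gz by simp
    then have "delta P (Z01 (Suc k) P) \<le> delta P (point_of_triple (N *v z))"
      using better light_ex Z01_435 b by metis
    then show ?thesis by (meson min.coboundedI2)
  next
    case c
    then have "g (vector [3, 4, 5]) \<le> g z"
      using right' arc(2) unfolding g_eq gz by (simp add: algebra_simps)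
    then have "delta P (Z10 (Suc k) P) \<le> delta P (point_of_triple (N *v z))"
      using better light_ex Z10_345 c by metis
    then show ?thesis by (meson min.coboundedI1)
  next
    case d
    then have "g (vector [3, 4, 5]) \<le> g z \<or> g (vector [1, 0, 1]) \<le> g z"
      using left' arc(3) unfolding g_eq gz by (simp add: algebra_simps)
    then have "delta P (Z10 (Suc k) P) \<le> delta P (point_of_triple (N *v z))
      \<or> delta P (Z10 k P) \<le> delta P (point_of_triple (N *v z))"
      using better light_ex Z10_345 Zk d by metis
    then show ?thesis by (meson min.coboundedI1)
  qed
qed

text \<open>Induction on the last entry of \<open>z\<close>, with \<open>k\<close> and
  \<open>z\<close> varying and \<open>v\<close> fixed, so that the height condition persists. Digits
  are stripped until \<open>z\<close> reaches an axis or is separated from the iterate of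
  \<open>P\<close>.\<close>

lemma descent:
  fixes P :: "real \<times> real" and z :: "int^3"
  assumes P: "P \<in> quarter_circle" and "light z"
    and "v = romik_product (romik_expansion P) k *v z"
    and "Ht (point_of_triple v) = v $ 3"
  shows "\<exists>j. min (delta P (Z10 j P)) (delta P (Z01 j P)) \<le> delta P (point_of_triple v)"
  using assms(2-)
proof (induction "nat (z $ 3)" arbitrary: k z rule: less_induct)
  case less
  let ?N = "romik_product (romik_expansion P) k"
  define d where "d = romik_digit ((romik ^^ k) P)"
  have sq: "(z $ 1)\<^sup>2 + (z $ 2)\<^sup>2 = (z $ 3)\<^sup>2" and nn: "z $ 1 \<ge> 0" "z $ 2 \<ge> 0" "z $ 3 > 0"
    using less.prems by (auto simp: light_def)
  have N_scale: "?N *v (c *s w) = c *s (?N *v w)" for c w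
    by (simp add: vec_eq_iff forall_3 matrix_vector_mult_def sum_3 algebra_simps)
  consider "z $ 1 = 0" | "z $ 2 = 0" | "z $ 1 > 0" "z $ 2 > 0" using nn by fastforce
  then show ?case
  proof cases
    case 1
    then have "z $ 2 = z $ 3" using sq nn by (simp add: power2_eq_iff_nonneg)
    \<comment> \<open>The pulled-back triple is a multiple of an endpoint's triple, and the multiple
      cancels in \<open>point_of_triple\<close>.\<close>
    with 1 have "z = z $ 3 *s vector [0, 1, 1]"
      by (simp add: vec_eq_iff forall_3)
    then have "v = z $ 3 *s (?N *v vector [0, 1, 1])"
      using less.prems(2) N_scale by metis
    then have "point_of_triple v = Z01 k P"
      using nn(3) by (simp add: Z01_def point_of_triple_scale)
    then show ?thesis by (metis min.cobounded2)
  next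
    case 2
    then have "z $ 1 = z $ 3" using sq nn by (simp add: power2_eq_iff_nonneg)
    with 2 have "z = z $ 3 *s vector [1, 0, 1]"
      by (simp add: vec_eq_iff forall_3)
    then have "v = z $ 3 *s (?N *v vector [1, 0, 1])"
      using less.prems(2) N_scale by metis
    then have "point_of_triple v = Z10 k P"
      using nn(3) by (simp add: Z10_def point_of_triple_scale)
    then show ?thesis by (metis min.cobounded1)
  next
    case 3
    show ?thesis
    proof (cases "d = 1 \<and> z$1 + 2 * z$2 \<le> 2 * z$3
       \<or> d = 2 \<and> z$1 + 2 * z$2 \<ge> 2 * z$3 \<and> 2 * z$1 + z$2 \<ge> 2 * z$3
       \<or> d = 3 \<and> 2 * z$1 + z$2 \<le> 2 * z$3")
      case True
      obtain w where w: "light w" "w $ 3 < z $ 3" "romik_matrix d *v w = z"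
        using light_preimage[OF less.prems(1) 3 True] by blast
      have "v = romik_product (romik_expansion P) (Suc k) *v w"
        using less.prems(2) w(3)
        by (simp add: romik_expansion_def d_def flip: matrix_vector_mul_assoc)
      then show ?thesis using less.hyps[of w "Suc k"] w(1,2) nn less.prems(3) by simp
    next
      case False
      moreover have "d = 1 \<or> d = 2 \<or> d = 3" unfolding d_def by (rule romik_digit_cases) auto
      ultimately have "d = 1 \<and> z$1 + 2 * z$2 > 2 * z$3
         \<or> d = 2 \<and> (z$1 + 2 * z$2 < 2 * z$3 \<or> 2 * z$1 + z$2 < 2 * z$3)
         \<or> d = 3 \<and> 2 * z$1 + z$2 > 2 * z$3" by linarith
      then show ?thesis
        using separated_better_endpoint[OF P less.prems(1) 3] less.prems(2,3) d_def by metis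
    qed
  qed
qed

theorem theorem2p9:
  fixes P Z :: "real \<times> real"
  assumes "P \<in> quarter_circle" and "\<not> rational_point P"
    and "Z \<in> quarter_circle" and "rational_point Z"
  shows "\<exists>k::nat. min (delta P (Z10 k P)) (delta P (Z01 k P)) \<le> delta P Z"
proof -
  obtain a b where ab: "0 < Ht Z" "Z = (of_int a / of_int (Ht Z), of_int b / of_int (Ht Z))"
    using Ht_attained[OF assms(4)] by metis
  define z :: "int^3" where "z = vector [a, b, Ht Z]"
  have Z: "point_of_triple z = Z"
    using ab(2) by (simp add: point_of_triple_def z_def)
  have "(real_of_int a / of_int (Ht Z))\<^sup>2 + (of_int b / of_int (Ht Z))\<^sup>2 = 1"
    and nn: "real_of_int a / of_int (Ht Z) \<ge> 0" "real_of_int b / of_int (Ht Z) \<ge> 0"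
    using assms(3) ab(2) unfolding quarter_circle_def by (metis (mono_tags, lifting) case_prodD mem_Collect_eq)+
  then have "(real_of_int a)\<^sup>2 + (of_int b)\<^sup>2 = (of_int (Ht Z))\<^sup>2"
    using ab(1) by (simp add: power_divide flip: add_divide_distrib)
  then have "a\<^sup>2 + b\<^sup>2 = (Ht Z)\<^sup>2"
    by (simp flip: of_int_power of_int_add)
  moreover have "a \<ge> 0" "b \<ge> 0" using nn ab(1) by (simp_all add: zero_le_divide_iff)
  ultimately have "light z" using ab(1) by (simp add: light_def z_def)
  \<comment> \<open>Taking the height itself as last entry supplies the reducedness that
    \<open>descent\<close> asks for at \<open>k = 0\<close>.\<close>
  moreover have "Ht (point_of_triple z) = z $ 3" unfolding Z by (simp add: z_def)
  ultimately show ?thesis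
    using descent[OF assms(1), of z z 0] Z by simp
qed

end
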